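(* Let $a,b,c>0$ be real numbers with $c\ge a+b+ab$, let $p\in\mathbb{R}$, and let $\mathcal{G}_p(x)=(1-x)^p\exp\left(F(a,b;c;x)\right)$ for $x\in(0,1)$. Then $-\mathcal{G}_p'$ is absolutely monotonic on $(0,1)$ if and only if $\frac{ab}{c}\le p\le 1$.
   Context: $F(a,b;c;x)=\sum_{n=0}^\infty\frac{(a)_n(b)_n}{(c)_n}\frac{x^n}{n!}$ is the Gaussian hypergeometric function, with $(a)_0=1$ and $(a)_n=a(a+1)\cdots(a+n-1)$ for $n\ge1$. A function $f$ is absolutely monotonic on an interval $I$ if all derivatives $f^{(k)}$ exist on $I$ and $f^{(k)}(x)\ge0$ for all $x\in I$ and all integers $k\ge0$. *)

theory Defs
  imports "HOL-Analysis.Analysis"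
begin

definition gauss_hypergeo :: "real \<Rightarrow> real \<Rightarrow> real \<Rightarrow> real \<Rightarrow> real" where
  "gauss_hypergeo a b c x =
     (\<Sum>n. pochhammer a n * pochhammer b n / pochhammer c n * (x ^ n / fact n))"

(* D k is the k-th derivative of f on I. Derivatives are taken within I, hence one-sided at
   endpoints belonging to I; on a nondegenerate interval they are unique. *)
definition absolutely_monotonic_on :: "(real \<Rightarrow> real) \<Rightarrow> real set \<Rightarrow> bool" where
  "absolutely_monotonic_on f I \<longleftrightarrow>
     (\<exists>D :: nat \<Rightarrow> real \<Rightarrow> real.
        (\<forall>x\<in>I. D 0 x = f x) \<and>
        (\<forall>k. \<forall>x\<in>I. (D k has_real_derivative D (Suc k) x) (at x within I)) \<and>
        (\<forall>k. \<forall>x\<in>I. 0 \<le> D k x))"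

definition G :: "real \<Rightarrow> real \<Rightarrow> real \<Rightarrow> real \<Rightarrow> real \<Rightarrow> real" where
  "G a b c p x = (1 - x) powr p * exp (gauss_hypergeo a b c x)"

end

theory Submission imports Defs begin

text \<open>
  Write \<open>F\<close> for the hypergeometric function, \<open>G\<^sub>p\<close> for \<open>G a b c p\<close>, and \<open>f\<^sub>n\<close> for the
  coefficients of \<open>F\<close>. Differentiation gives the factorisation
  \<open>- G\<^sub>p' = G\<^sub>p\<^sub>-\<^sub>1 * (p - (1 - x) F')\<close> (lemma \<open>minus_deriv_G\<close>), and everything rests on the
  second factor. The coefficients of \<open>(1 - x) F'\<close> are
  \<open>(n + 1) f\<^sub>n\<^sub>+\<^sub>1 - n f\<^sub>n = f\<^sub>n (a b - n (c - a - b)) / (c + n)\<close>. The one with \<open>n = 0\<close> is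
  \<open>a b / c\<close>, and the hypothesis on \<open>c\<close> says exactly that all others are at most \<open>0\<close>. So
  \<open>a b / c - (1 - x) F'\<close> has a power series with non-negative coefficients
  (lemma \<open>nonneg_powser_defect\<close>).

  Sufficiency. Let \<open>a b / c \<le> p \<le> 1\<close> and \<open>W = G\<^sub>p\<^sub>-\<^sub>1\<close>. Then \<open>W' = W * (F' + (1 - p) / (1 - x))\<close>,
  where the logarithmic derivative has a non-negative power series. The functions \<open>W * Q\<close>, with
  \<open>Q\<close> ranging over the non-negative power series, therefore form a class closed under
  differentiation, so all of them are absolutely monotonic
  (lemma \<open>absolutely_monotonic_on_mult_nonneg_powser\<close>), and \<open>- G\<^sub>p'\<close> is one of them.

  Necessity. Non-negativity of \<open>- G\<^sub>p'\<close> gives \<open>(1 - x) F' \<le> p\<close>, whence \<open>a b / c \<le> p\<close> as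
  \<open>x\<close> tends to \<open>0\<close>. If \<open>p > 1\<close>, then \<open>- G\<^sub>p'\<close> is positive at \<open>1/2\<close> and non-decreasing; but
  \<open>F\<close> is bounded (lemma \<open>summable_hyp_coeff\<close>), so \<open>- G\<^sub>p'\<close> is at most a constant times
  \<open>(1 - x) powr (p - 1)\<close> and tends to \<open>0\<close> at \<open>1\<close>, a contradiction.
\<close>

section \<open>Functions with non-negative power series\<close>

definition nonneg_powser :: "(real \<Rightarrow> real) \<Rightarrow> bool" where
  "nonneg_powser f \<longleftrightarrow>
     (\<exists>u. (\<forall>n. 0 \<le> u n) \<and> (\<forall>x\<in>{0<..<1}. (\<lambda>n. u n * x ^ n) sums f x))"

lemma nonneg_powserI:
  assumes "\<And>n. 0 \<le> u n" "\<And>x. 0 < x \<Longrightarrow> x < 1 \<Longrightarrow> (\<lambda>n. u n * x ^ n) sums f x"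
  shows "nonneg_powser f"
  using assms unfolding nonneg_powser_def by (intro exI[of _ u]) simp

lemma nonneg_powserE:
  assumes "nonneg_powser f"
  obtains u where "\<And>n. 0 \<le> u n" "\<And>x. 0 < x \<Longrightarrow> x < 1 \<Longrightarrow> (\<lambda>n. u n * x ^ n) sums f x"
proof -
  from assms obtain u where "\<forall>n. 0 \<le> u n" "\<forall>x\<in>{0<..<1}. (\<lambda>n. u n * x ^ n) sums f x"
    unfolding nonneg_powser_def by blast
  then show thesis by (intro that[of u]) simp_all
qed

lemma nonneg_powser_nonneg:
  assumes "nonneg_powser f" "0 < x" "x < 1"
  shows "0 \<le> f x"
proof -
  obtain u where u: "\<And>n. 0 \<le> u n" "\<And>x. 0 < x \<Longrightarrow> x < 1 \<Longrightarrow> (\<lambda>n. u n * x ^ n) sums f x"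
    using nonneg_powserE[OF assms(1)] by blast
  show ?thesis
    using u(1) assms(2) by (intro sums_le[OF _ sums_zero u(2)[OF assms(2,3)]]) simp
qed

lemma nonneg_powser_add:
  assumes "nonneg_powser f" "nonneg_powser g"
  shows "nonneg_powser (\<lambda>x. f x + g x)"
proof -
  obtain u where u: "\<And>n. 0 \<le> u n" "\<And>x. 0 < x \<Longrightarrow> x < 1 \<Longrightarrow> (\<lambda>n. u n * x ^ n) sums f x"
    using nonneg_powserE[OF assms(1)] by blast
  obtain v where v: "\<And>n. 0 \<le> v n" "\<And>x. 0 < x \<Longrightarrow> x < 1 \<Longrightarrow> (\<lambda>n. v n * x ^ n) sums g x"
    using nonneg_powserE[OF assms(2)] by blast
  show ?thesis
  proof (rule nonneg_powserI[where u = "\<lambda>n. u n + v n"])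
    fix x :: real assume "0 < x" "x < 1"
    then show "(\<lambda>n. (u n + v n) * x ^ n) sums (f x + g x)"
      using sums_add[OF u(2) v(2), of x x] by (simp add: distrib_right)
  qed (simp add: u(1) v(1))
qed

lemma nonneg_powser_mult:
  assumes "nonneg_powser f" "nonneg_powser g"
  shows "nonneg_powser (\<lambda>x. f x * g x)"
proof -
  obtain u where u: "\<And>n. 0 \<le> u n" "\<And>x. 0 < x \<Longrightarrow> x < 1 \<Longrightarrow> (\<lambda>n. u n * x ^ n) sums f x"
    using nonneg_powserE[OF assms(1)] by blast
  obtain v where v: "\<And>n. 0 \<le> v n" "\<And>x. 0 < x \<Longrightarrow> x < 1 \<Longrightarrow> (\<lambda>n. v n * x ^ n) sums g x"
    using nonneg_powserE[OF assms(2)] by blast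
  show ?thesis
  proof (rule nonneg_powserI[where u = "\<lambda>n. \<Sum>i\<le>n. u i * v (n - i)"])
    fix n show "0 \<le> (\<Sum>i\<le>n. u i * v (n - i))"
      by (intro sum_nonneg mult_nonneg_nonneg u v)
  next
    fix x :: real assume x: "0 < x" "x < 1"
    have "summable (\<lambda>n. norm (u n * x ^ n))" "summable (\<lambda>n. norm (v n * x ^ n))"
      using sums_summable[OF u(2)[OF x]] sums_summable[OF v(2)[OF x]] u(1) v(1) x
      by (simp_all add: abs_mult)
    from Cauchy_product_sums[OF this]
    have "(\<lambda>n. \<Sum>i\<le>n. (u i * x ^ i) * (v (n - i) * x ^ (n - i))) sums (f x * g x)"
      using sums_unique[OF u(2)[OF x]] sums_unique[OF v(2)[OF x]] by simp
    moreover have "(\<Sum>i\<le>n. (u i * x ^ i) * (v (n - i) * x ^ (n - i)))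
        = (\<Sum>i\<le>n. u i * v (n - i)) * x ^ n" for n
      unfolding sum_distrib_right
    proof (rule sum.cong[OF refl])
      fix i assume "i \<in> {..n}"
      then have "x ^ n = x ^ i * x ^ (n - i)" by (simp flip: power_add)
      then show "u i * x ^ i * (v (n - i) * x ^ (n - i)) = u i * v (n - i) * x ^ n"
        by simp
    qed
    ultimately show "(\<lambda>n. (\<Sum>i\<le>n. u i * v (n - i)) * x ^ n) sums (f x * g x)"
      by simp
  qed
qed

text \<open>
  Differentiability is local, so a function that agrees with the series just on the open unit
  interval can be differentiated termwise there.
\<close>

lemma powser_deriv_unit_interval:
  fixes u :: "nat \<Rightarrow> real"
  assumes u: "\<And>x. 0 < x \<Longrightarrow> x < 1 \<Longrightarrow> (\<lambda>n. u n * x ^ n) sums f x"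
    and x: "0 < x" "x < 1"
  shows "(\<lambda>n. diffs u n * x ^ n) sums deriv f x"
    and "(f has_real_derivative deriv f x) (at x)"
proof -
  \<comment> \<open>Convergence at any point strictly between \<open>x\<close> and \<open>1\<close> justifies the termwise derivative at \<open>x\<close>.\<close>
  define K where "K = (1 + x) / 2"
  have K: "0 < K" "K < 1" "x < K" using x by (auto simp: K_def)
  have sK: "summable (\<lambda>n. u n * K ^ n)"
    using u[OF K(1,2)] by (rule sums_summable)
  have "((\<lambda>x. \<Sum>n. u n * x ^ n) has_real_derivative (\<Sum>n. diffs u n * x ^ n)) (at x)"
    using termdiffs_strong[OF sK, of x] K x by simp
  then have der: "(f has_real_derivative (\<Sum>n. diffs u n * x ^ n)) (at x)"
  proof (rule has_field_derivative_transform_within_open)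
    show "open {0<..<1::real}" by simp
    show "x \<in> {0<..<1}" using x by simp
    show "(\<Sum>n. u n * y ^ n) = f y" if "y \<in> {0<..<1}" for y
      using sums_unique[OF u[of y]] that by simp
  qed
  then have eq: "deriv f x = (\<Sum>n. diffs u n * x ^ n)" by (rule DERIV_imp_deriv)
  have "summable (\<lambda>n. diffs u n * x ^ n)"
  proof (rule termdiff_converges)
    show "norm x < K" using K x by simp
    show "summable (\<lambda>n. u n * y ^ n)" if "norm y < K" for y
      using powser_inside[OF sK, of y] that K by simp
  qed
  then show "(\<lambda>n. diffs u n * x ^ n) sums deriv f x"
    unfolding eq by (rule summable_sums)
  show "(f has_real_derivative deriv f x) (at x)" using der eq by simp
qed

lemma nonneg_powser_deriv:
  assumes "nonneg_powser f"
  shows "nonneg_powser (deriv f)"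
    and "0 < x \<Longrightarrow> x < 1 \<Longrightarrow> (f has_real_derivative deriv f x) (at x)"
proof -
  obtain u where u: "\<And>n. 0 \<le> u n" "\<And>x. 0 < x \<Longrightarrow> x < 1 \<Longrightarrow> (\<lambda>n. u n * x ^ n) sums f x"
    using nonneg_powserE[OF assms] by blast
  show "nonneg_powser (deriv f)"
    by (rule nonneg_powserI[where u = "diffs u"])
       (use u(1) powser_deriv_unit_interval(1)[OF u(2)] in \<open>auto simp: diffs_def\<close>)
  show "0 < x \<Longrightarrow> x < 1 \<Longrightarrow> (f has_real_derivative deriv f x) (at x)"
    by (rule powser_deriv_unit_interval(2)[OF u(2)])
qed


section \<open>Criteria for absolute monotonicity\<close>

text \<open>
  Choosing a derivative inside the class and iterating the choice gives all higher derivatives,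
  each of them non-negative as a member of the class.
\<close>

lemma absolutely_monotonic_on_if_closed_class:
  assumes nonneg: "\<And>f x. f \<in> C \<Longrightarrow> x \<in> I \<Longrightarrow> 0 \<le> f x"
    and closed: "\<And>f. f \<in> C \<Longrightarrow>
      \<exists>g\<in>C. \<forall>x\<in>I. (f has_real_derivative g x) (at x within I)"
    and "f \<in> C"
  shows "absolutely_monotonic_on f I"
proof -
  obtain d where d: "\<And>f. f \<in> C \<Longrightarrow> d f \<in> C"
    "\<And>f x. f \<in> C \<Longrightarrow> x \<in> I \<Longrightarrow> (f has_real_derivative d f x) (at x within I)"
    using closed by metis
  have "(d ^^ k) f \<in> C" for k
    by (induction k) (use \<open>f \<in> C\<close> d(1) in auto)
  then show ?thesis
    unfolding absolutely_monotonic_on_def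
    by (intro exI[where x = "\<lambda>k. (d ^^ k) f"]) (use nonneg d in simp)
qed

text \<open>
  The products of \<open>W\<close> with non-negative power series are closed under differentiation, because
  \<open>(W Q)' = W (H Q + Q')\<close>. The lemma covers \<open>W = exp h\<close> for any \<open>h\<close> whose derivative has a
  non-negative power series.
\<close>

lemma absolutely_monotonic_on_mult_nonneg_powser:
  assumes W: "\<And>x. 0 < x \<Longrightarrow> x < 1 \<Longrightarrow> 0 \<le> W x"
    "\<And>x. 0 < x \<Longrightarrow> x < 1 \<Longrightarrow> (W has_real_derivative W x * H x) (at x)"
    and "nonneg_powser H" "nonneg_powser K"
  shows "absolutely_monotonic_on (\<lambda>x. W x * K x) {0<..<1}"
proof (rule absolutely_monotonic_on_if_closed_class
    [where C = "(\<lambda>Q x. W x * Q x) ` Collect nonneg_powser"])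
  fix f x assume "f \<in> (\<lambda>Q x. W x * Q x) ` Collect nonneg_powser" "x \<in> {0<..<1::real}"
  then show "0 \<le> f x" using W(1) nonneg_powser_nonneg by auto
next
  fix f assume "f \<in> (\<lambda>Q x. W x * Q x) ` Collect nonneg_powser"
  then obtain Q where Q: "nonneg_powser Q" "f = (\<lambda>x. W x * Q x)" by auto
  let ?R = "\<lambda>x. H x * Q x + deriv Q x"
  have "(f has_real_derivative W x * ?R x) (at x)" if "0 < x" "x < 1" for x
    unfolding Q(2)
    by (rule derivative_eq_intros W(2) nonneg_powser_deriv(2) Q that refl)+
       (simp add: algebra_simps)
  moreover have "nonneg_powser ?R"
    using assms(3) Q(1)
    by (intro nonneg_powser_add nonneg_powser_mult nonneg_powser_deriv(1))
  ultimately show "\<exists>g\<in>(\<lambda>Q x. W x * Q x) ` Collect nonneg_powser.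
      \<forall>x\<in>{0<..<1}. (f has_real_derivative g x) (at x within {0<..<1})"
    by (intro bexI[where x = "\<lambda>x. W x * ?R x"] image_eqI[where x = ?R])
       (auto intro: has_field_derivative_at_within)
qed (use assms in auto)

lemma absolutely_monotonic_on_nonneg:
  assumes "absolutely_monotonic_on f I" "x \<in> I"
  shows "0 \<le> f x"
  using assms unfolding absolutely_monotonic_on_def by metis

lemma absolutely_monotonic_on_mono_on:
  assumes f: "absolutely_monotonic_on f {s<..<t}" and xy: "s < x" "x \<le> y" "y < t"
  shows "f x \<le> f y"
proof -
  obtain D where D: "\<forall>x\<in>{s<..<t}. D 0 x = f x"
    "\<forall>k. \<forall>x\<in>{s<..<t}. (D k has_real_derivative D (Suc k) x) (at x within {s<..<t})"
    "\<forall>k. \<forall>x\<in>{s<..<t}. 0 \<le> D k x"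
    using f unfolding absolutely_monotonic_on_def by auto
  have "D 0 x \<le> D 0 y"
  proof (rule DERIV_nonneg_imp_nondecreasing[OF xy(2)])
    fix z assume "x \<le> z" "z \<le> y"
    then have z: "z \<in> {s<..<t}" using xy by auto
    then have "(D 0 has_real_derivative D (Suc 0) z) (at z)"
      using D(2) by (simp flip: at_within_open[OF z open_greaterThanLessThan])
    then show "\<exists>w. (D 0 has_real_derivative w) (at z) \<and> 0 \<le> w"
      using D(3) z by blast
  qed
  then show ?thesis using D(1) xy by simp
qed


section \<open>The hypergeometric coefficients\<close>

definition hyp_coeff :: "real \<Rightarrow> real \<Rightarrow> real \<Rightarrow> nat \<Rightarrow> real" where
  "hyp_coeff a b c n = pochhammer a n * pochhammer b n / (pochhammer c n * fact n)"

lemma hyp_coeff_0 [simp]: "hyp_coeff a b c 0 = 1"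
  by (simp add: hyp_coeff_def)

lemma gauss_hypergeo_eq: "gauss_hypergeo a b c x = (\<Sum>n. hyp_coeff a b c n * x ^ n)"
  by (simp add: gauss_hypergeo_def hyp_coeff_def)

context
  fixes a b c :: real
  assumes a: "a > 0" and b: "b > 0" and c: "c > 0" and abc: "c \<ge> a + b + a * b"
begin

lemma hyp_coeff_nonneg: "0 \<le> hyp_coeff a b c n"
  unfolding hyp_coeff_def using a b c
  by (intro divide_nonneg_nonneg mult_nonneg_nonneg pochhammer_nonneg) auto

lemma diffs_hyp_coeff:
  "diffs (hyp_coeff a b c) n = hyp_coeff a b c n * ((a + n) * (b + n) / (c + n))"
proof -
  have "diffs (hyp_coeff a b c) n = real (Suc n) * (pochhammer a n * (a + n)
      * (pochhammer b n * (b + n)) / (pochhammer c n * (c + n) * (real (Suc n) * fact n)))"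
    by (simp add: diffs_def hyp_coeff_def pochhammer_Suc)
  moreover have "s * (A / (B * (s * t))) = A / (B * t)" if "s \<noteq> 0" for s t A B :: real
    using that by simp
  ultimately show ?thesis
    by (simp only: hyp_coeff_def times_divide_times_eq mult_ac of_nat_eq_0_iff nat.simps)
       (simp add: mult_ac)
qed

text \<open>
  The \<open>n\<close>-th coefficient of \<open>(x - 1) F'(x)\<close>, which is also the step from \<open>(n + 1) f\<^sub>n\<^sub>+\<^sub>1\<close> back to
  \<open>n f\<^sub>n\<close>.
\<close>

lemma hyp_coeff_drop:
  "n * hyp_coeff a b c n - diffs (hyp_coeff a b c) n
     = hyp_coeff a b c n * ((n * (c - a - b) - a * b) / (c + n))"
proof -
  have "c + n > 0" using c by simp
  then have "n - (a + n) * (b + n) / (c + n) = (n * (c - a - b) - a * b) / (c + n)"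
    by (simp add: field_simps)
  then show ?thesis
    unfolding diffs_hyp_coeff by (metis mult.commute right_diff_distrib)
qed

text \<open>
  The condition \<open>c \<ge> a + b + a b\<close> enters here: it is \<open>n (c - a - b) \<ge> a b\<close> for \<open>n = 1\<close>, and
  hence for every larger \<open>n\<close>.
\<close>

lemma hyp_coeff_drop_nonneg:
  assumes "n > 0"
  shows "diffs (hyp_coeff a b c) n \<le> n * hyp_coeff a b c n"
proof -
  have "a * b \<le> c - a - b" using abc by simp
  also have "\<dots> \<le> n * (c - a - b)"
    using assms abc mult_pos_pos[OF a b] mult_right_mono[of 1 "real n" "c - a - b"] by simp
  finally have "0 \<le> (n * (c - a - b) - a * b) / (c + n)" using c by simp
  then have "0 \<le> hyp_coeff a b c n * ((n * (c - a - b) - a * b) / (c + n))"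
    by (rule mult_nonneg_nonneg[OF hyp_coeff_nonneg])
  then show ?thesis using hyp_coeff_drop[of n] by linarith
qed

text \<open>
  The series converges even at \<open>x = 1\<close>. The numbers \<open>n f\<^sub>n\<close> with \<open>n \<ge> 1\<close> decrease and are
  non-negative, so the series of their drops telescopes and converges; and from \<open>n = 2\<close> on the
  drop at \<open>n\<close> is at least a fixed positive multiple of \<open>f\<^sub>n\<close>.
\<close>

lemma summable_hyp_coeff: "summable (hyp_coeff a b c)"
proof -
  define f where "f = hyp_coeff a b c"
  define d where "d = c - a - b"
  have d: "d \<ge> a * b" "d > 0" using abc mult_pos_pos[OF a b] by (simp_all add: d_def)
  define g where "g n = Suc n * f (Suc n)" for n
  have g: "g n = diffs f n" for n by (simp add: g_def diffs_def)
  have f: "f n \<ge> 0" for n using hyp_coeff_nonneg by (simp add: f_def)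
  have "decseq g"
  proof (rule decseq_SucI)
    show "g (Suc n) \<le> g n" for n
      using hyp_coeff_drop_nonneg[of "Suc n"] by (simp only: g[of "Suc n"] g_def[of n] f_def)
  qed
  moreover have "\<forall>n. 0 \<le> g n" using f by (simp add: g_def)
  ultimately obtain L where "g \<longlonglongrightarrow> L" using decseq_convergent[of g 0] by metis
  then have sum: "summable (\<lambda>n. g n - g (Suc n))" by (rule telescope_summable')
  then have "summable (\<lambda>n. (c + 2) / d * (g (Suc n) - g (Suc (Suc n))))"
    by (intro summable_mult) (subst summable_Suc_iff)
  \<comment> \<open>For \<open>m \<ge> 2\<close>, \<open>(m d - a b) / (c + m) \<ge> d (m - 1) / (c + m) \<ge> d / (c + 2)\<close>. For \<open>m = 1\<close> the
      left side is \<open>0\<close> when \<open>c = a + b + a b\<close>, so the comparison starts at \<open>2\<close>.\<close>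
  moreover have "norm (f (Suc (Suc n))) \<le> (c + 2) / d * (g (Suc n) - g (Suc (Suc n)))" for n
  proof -
    let ?m = "Suc (Suc n)"
    have "d \<le> (c + 2) * ((?m * d - a * b) / (c + ?m))"
    proof -
      have "d * (c + ?m) \<le> (c + 2) * (d * (n + 1))"
        using c d by (simp add: field_simps)
      also have "\<dots> \<le> (c + 2) * (?m * d - a * b)"
        using c d by (intro mult_left_mono) (auto simp: algebra_simps)
      finally show ?thesis using c by (simp add: field_simps)
    qed
    then have "f ?m * d \<le> f ?m * ((c + 2) * ((?m * d - a * b) / (c + ?m)))"
      using f by (intro mult_left_mono) auto
    also have "\<dots> = (c + 2) * (g (Suc n) - g ?m)"
      using hyp_coeff_drop[of ?m] g[of ?m] by (simp add: g_def f_def d_def)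
    finally show ?thesis using d f by (simp add: field_simps)
  qed
  ultimately have "summable (\<lambda>n. f (Suc (Suc n)))" by (rule summable_comparison_test'[where N = 0])
  then have "summable (\<lambda>n. f (Suc n))" by (subst (asm) summable_Suc_iff)
  then show ?thesis unfolding f_def by (subst (asm) summable_Suc_iff)
qed

lemma gauss_hypergeo_sums:
  assumes "0 < x" "x < 1"
  shows "(\<lambda>n. hyp_coeff a b c n * x ^ n) sums gauss_hypergeo a b c x"
  unfolding gauss_hypergeo_eq
  using powser_inside[of "hyp_coeff a b c" 1 x] summable_hyp_coeff assms
  by (intro summable_sums) simp

lemma gauss_hypergeo_le:
  assumes "0 < x" "x < 1"
  shows "gauss_hypergeo a b c x \<le> (\<Sum>n. hyp_coeff a b c n)"
proof (rule sums_le[OF _ gauss_hypergeo_sums[OF assms] summable_sums[OF summable_hyp_coeff]])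
  show "hyp_coeff a b c n * x ^ n \<le> hyp_coeff a b c n" for n
    using assms hyp_coeff_nonneg by (simp add: mult_left_le power_le_one)
qed

lemma nonneg_powser_gauss_hypergeo: "nonneg_powser (gauss_hypergeo a b c)"
  using hyp_coeff_nonneg gauss_hypergeo_sums by (rule nonneg_powserI)

text \<open>
  The key sign property: subtracting \<open>(1 - x) F'\<close> from its value at \<open>0\<close> leaves a series
  whose coefficients are the drops of \<open>n f\<^sub>n\<close>.
\<close>

lemma nonneg_powser_defect:
  "nonneg_powser (\<lambda>x. a * b / c - (1 - x) * deriv (gauss_hypergeo a b c) x)"
proof -
  define f where "f = hyp_coeff a b c"
  show ?thesis
  proof (rule nonneg_powserI)
    fix n show "0 \<le> (if n = 0 then a * b / c else 0) - (diffs f n - n * f n)"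
      using hyp_coeff_drop_nonneg[of n] diffs_hyp_coeff[of 0] by (auto simp: f_def)
  next
    fix x :: real assume x: "0 < x" "x < 1"
    let ?F' = "deriv (gauss_hypergeo a b c) x"
    have F': "(\<lambda>n. diffs f n * x ^ n) sums ?F'"
      unfolding f_def by (rule powser_deriv_unit_interval(1)[OF gauss_hypergeo_sums x])
    have "(\<lambda>n. real n * f n * x ^ (n - Suc 0)) sums ?F'"
      using diffs_equiv[OF sums_summable[OF F']] sums_unique[OF F'] by simp
    from sums_mult[OF this, of x]
    have "(\<lambda>n. x * (real n * f n * x ^ (n - Suc 0))) sums (x * ?F')" .
    moreover have "x * (real n * f n * x ^ (n - Suc 0)) = n * f n * x ^ n" for n
      by (cases n) simp_all
    ultimately have "(\<lambda>n. n * f n * x ^ n) sums (x * ?F')" by simp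
    from sums_diff[OF sums_single[of 0 "\<lambda>n. a * b / c"] sums_diff[OF F' this]]
    have "(\<lambda>n. (if n = 0 then a * b / c else 0) - (diffs f n * x ^ n - n * f n * x ^ n)) sums
        (a * b / c - (?F' - x * ?F'))" .
    moreover have "(if n = 0 then a * b / c else 0) - (diffs f n * x ^ n - n * f n * x ^ n)
        = ((if n = 0 then a * b / c else 0) - (diffs f n - n * f n)) * x ^ n" for n
      by (simp add: algebra_simps)
    ultimately show "(\<lambda>n. ((if n = 0 then a * b / c else 0) - (diffs f n - n * f n)) * x ^ n) sums
        (a * b / c - (1 - x) * ?F')"
      by (simp only: left_diff_distrib mult_1)
  qed
qed

lemma deriv_gauss_hypergeo_ge:
  assumes "0 < x" "x < 1"
  shows "a * b / c \<le> deriv (gauss_hypergeo a b c) x"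
proof -
  have "(\<lambda>n. diffs (hyp_coeff a b c) n * x ^ n) sums deriv (gauss_hypergeo a b c) x"
    by (rule powser_deriv_unit_interval(1)[OF gauss_hypergeo_sums assms])
  with sums_single[of 0 "\<lambda>n. a * b / c"] show ?thesis
  proof (rule sums_le[rotated])
    fix n
    have "0 \<le> diffs (hyp_coeff a b c) n" using hyp_coeff_nonneg by (simp add: diffs_def)
    then show "(if n = 0 then a * b / c else 0) \<le> diffs (hyp_coeff a b c) n * x ^ n"
      using assms diffs_hyp_coeff[of 0] by simp
  qed
qed


section \<open>The derivative of the weighted exponential\<close>

text \<open>
  The derivative is put in the form \<open>W' = W H\<close>, with the logarithmic derivative as a separate
  factor, to match \<open>absolutely_monotonic_on_mult_nonneg_powser\<close>.
\<close>

lemma has_real_derivative_G: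
  assumes "0 < x" "x < 1"
  shows "(G a b c q has_real_derivative
    G a b c q x * (deriv (gauss_hypergeo a b c) x - q / (1 - x))) (at x)"
proof -
  have "G a b c q = (\<lambda>x. (1 - x) powr q * exp (gauss_hypergeo a b c x))"
    by (simp add: G_def fun_eq_iff)
  moreover have "((\<lambda>x. (1 - x) powr q * exp (gauss_hypergeo a b c x)) has_real_derivative
      (1 - x) powr q * exp (gauss_hypergeo a b c x)
        * (deriv (gauss_hypergeo a b c) x - q / (1 - x))) (at x)"
    using assms nonneg_powser_deriv(2)[OF nonneg_powser_gauss_hypergeo assms]
    by (auto intro!: derivative_eq_intros simp: powr_diff algebra_simps)
  ultimately show ?thesis by simp
qed

lemma minus_deriv_G:
  assumes "0 < x" "x < 1"
  shows "- deriv (G a b c p) x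
    = G a b c (p - 1) x * (p - (1 - x) * deriv (gauss_hypergeo a b c) x)"
proof -
  have "G a b c p x = (1 - x) * G a b c (p - 1) x"
    using assms by (simp add: G_def powr_diff)
  then have "- deriv (G a b c p) x = G a b c (p - 1) x
      * ((1 - x) * (p / (1 - x) - deriv (gauss_hypergeo a b c) x))"
    using DERIV_imp_deriv[OF has_real_derivative_G[OF assms, of p]]
    by (simp add: minus_mult_right)
  also have "(1 - x) * (p / (1 - x) - deriv (gauss_hypergeo a b c) x)
      = p - (1 - x) * deriv (gauss_hypergeo a b c) x"
    using assms by (simp only: right_diff_distrib) simp
  finally show ?thesis .
qed

lemma G_pos: "x < 1 \<Longrightarrow> 0 < G a b c q x"
  by (simp add: G_def)

section \<open>Sufficiency and necessity of the bounds\<close>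

lemma absolutely_monotonic_if:
  assumes p: "a * b / c \<le> p" "p \<le> 1"
  shows "absolutely_monotonic_on (\<lambda>x. - deriv (G a b c p) x) {0<..<1}"
proof -
  let ?F' = "deriv (gauss_hypergeo a b c)"
  have geom: "nonneg_powser (\<lambda>x. (1 - p) / (1 - x))"
  proof (rule nonneg_powserI)
    fix x :: real assume "0 < x" "x < 1"
    then show "(\<lambda>n. (1 - p) * x ^ n) sums ((1 - p) / (1 - x))"
      using sums_mult[OF geometric_sums[of x], of "1 - p"] by simp
  qed (use p in simp)
  have const: "nonneg_powser (\<lambda>x. p - a * b / c)"
  proof (rule nonneg_powserI)
    fix x :: real
    show "(\<lambda>n. (if n = 0 then p - a * b / c else 0) * x ^ n) sums (p - a * b / c)"
      using sums_If_finite_set[of "{0::nat}" "\<lambda>n. (p - a * b / c) * x ^ n"]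
      by (simp add: if_distrib[of "\<lambda>y. y * _"] cong: if_cong)
  qed (use p in simp)
  \<comment> \<open>Inserting \<open>a b / c\<close> splits \<open>p - (1 - x) F'\<close> into two non-negative power series.\<close>
  have "absolutely_monotonic_on
      (\<lambda>x. G a b c (p - 1) x * ((p - a * b / c) + (a * b / c - (1 - x) * ?F' x))) {0<..<1}"
  proof (rule absolutely_monotonic_on_mult_nonneg_powser)
    fix x :: real assume x: "0 < x" "x < 1"
    show "0 \<le> G a b c (p - 1) x" using G_pos x by (simp add: less_imp_le)
    show "(G a b c (p - 1) has_real_derivative
        G a b c (p - 1) x * (?F' x + (1 - p) / (1 - x))) (at x)"
      using has_real_derivative_G[OF x, of "p - 1"]
      by (simp add: diff_divide_distrib algebra_simps)
  qed (intro nonneg_powser_add geom const nonneg_powser_defect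
        nonneg_powser_deriv(1) nonneg_powser_gauss_hypergeo)+
  then show ?thesis
    unfolding absolutely_monotonic_on_def by (simp add: minus_deriv_G)
qed

text \<open>
  Non-negativity alone forces the lower bound: it says \<open>(1 - x) F'(x) \<le> p\<close>, and
  \<open>F'(x) \<ge> a b / c\<close>; now let \<open>x\<close> tend to \<open>0\<close>.
\<close>

lemma lower_bound_if_absolutely_monotonic:
  assumes "absolutely_monotonic_on (\<lambda>x. - deriv (G a b c p) x) {0<..<1}"
  shows "a * b / c \<le> p"
proof -
  have bound: "(1 - x) * (a * b / c) \<le> p" if x: "0 < x" "x < 1" for x
  proof -
    have "0 \<le> G a b c (p - 1) x * (p - (1 - x) * deriv (gauss_hypergeo a b c) x)"
      using absolutely_monotonic_on_nonneg[OF assms, of x] x by (simp add: minus_deriv_G)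
    then have "(1 - x) * deriv (gauss_hypergeo a b c) x \<le> p"
      using G_pos[of x "p - 1"] x by (simp add: zero_le_mult_iff)
    moreover have "(1 - x) * (a * b / c) \<le> (1 - x) * deriv (gauss_hypergeo a b c) x"
      using deriv_gauss_hypergeo_ge[OF x] x by (intro mult_left_mono) auto
    ultimately show ?thesis by linarith
  qed
  have "((\<lambda>x. (1 - x) * (a * b / c)) \<longlongrightarrow> (1 - 0) * (a * b / c)) (at_right 0)"
    by (intro tendsto_intros)
  moreover have "\<forall>\<^sub>F x in at_right 0. (1 - x) * (a * b / c) \<le> p"
    using eventually_at_right_real[OF zero_less_one]
    by (rule eventually_mono) (use bound in auto)
  ultimately show ?thesis
    using tendsto_upperbound by fastforce
qed

text \<open>
  For \<open>p > 1\<close> the factor \<open>(1 - x) powr (p - 1)\<close> drives \<open>- G\<^sub>p'\<close> to \<open>0\<close> at \<open>1\<close>, since \<open>F\<close> stays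
  bounded; a non-decreasing function with a positive value cannot do that.
\<close>

lemma upper_bound_if_absolutely_monotonic:
  assumes mono: "absolutely_monotonic_on (\<lambda>x. - deriv (G a b c p) x) {0<..<1}"
  shows "p \<le> 1"
proof (rule ccontr)
  assume "\<not> p \<le> 1"
  then have p: "1 < p" by simp
  define m where "m = - deriv (G a b c p) (1/2)"
  define M where "M = exp (\<Sum>n. hyp_coeff a b c n) * p"
  have "a * b < c" using abc a b by simp
  then have "a * b / c < 1" using c by simp
  then have "a * b / c < p" using p by linarith
  moreover have "0 \<le> a * b / c - (1 - 1/2) * deriv (gauss_hypergeo a b c) (1/2)"
    by (rule nonneg_powser_nonneg[OF nonneg_powser_defect]) simp_all
  ultimately have "0 < p - (1 - 1/2) * deriv (gauss_hypergeo a b c) (1/2)" by linarith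
  then have m: "0 < m"
    unfolding m_def by (subst minus_deriv_G) (use G_pos[of "1/2" "p - 1"] in auto)
  have bound: "m \<le> (1 - x) powr (p - 1) * M" if x: "1/2 < x" "x < 1" for x
  proof -
    have "m \<le> G a b c (p - 1) x * (p - (1 - x) * deriv (gauss_hypergeo a b c) x)"
      using absolutely_monotonic_on_mono_on[OF mono, of "1/2" x] x
      by (simp add: m_def minus_deriv_G)
    also have "\<dots> \<le> G a b c (p - 1) x * p"
      using nonneg_powser_nonneg[OF nonneg_powser_deriv(1)[OF nonneg_powser_gauss_hypergeo], of x]
        G_pos[of x "p - 1"] x
      by (intro mult_left_mono) auto
    also have "\<dots> \<le> (1 - x) powr (p - 1) * M"
      unfolding G_def M_def using gauss_hypergeo_le[of x] x p
      by (simp add: mult_left_mono mult_right_mono)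
    finally show ?thesis .
  qed
  have "((\<lambda>x. (1 - x) powr (p - 1) * M) \<longlongrightarrow> (1 - 1) powr (p - 1) * M) (at_left 1)"
    using p by (intro tendsto_intros tendsto_powr') (auto simp: eventually_at_filter)
  moreover have "\<forall>\<^sub>F x in at_left 1. m \<le> (1 - x) powr (p - 1) * M"
    using eventually_at_left_real[of "1/2" "1::real", simplified]
    by (rule eventually_mono) (use bound in auto)
  ultimately have "m \<le> (1 - 1) powr (p - 1) * M"
    using tendsto_lowerbound by fastforce
  then show False using m by simp
qed

end

theorem theorem4:
  fixes a b c p :: real
  assumes "a > 0" "b > 0" "c > 0"
    and "c \<ge> a + b + a * b"
  shows "absolutely_monotonic_on (\<lambda>x. - deriv (G a b c p) x) {0<..<1} \<longleftrightarrow>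
           a * b / c \<le> p \<and> p \<le> 1"
  using absolutely_monotonic_if[OF assms] lower_bound_if_absolutely_monotonic[OF assms]
    upper_bound_if_absolutely_monotonic[OF assms]
  by blast

end
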